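(* Let $(X,\mathcal{F},\lambda)$ be a measure space with $\sigma$-finite measure $\lambda$ and let $\mathcal{B}=\{B_k\}_{k\ge1}\in\mathcal{P}(X)$. Let $\mathcal{V}$ be a QSO with transition kernel $P$, and assume that $P$ satisfies the following conditions: (i) $P(u,v,\cdot)\in M(X,\mathcal{B})$ for all $(u,v)\in X^2$; (ii) there exists a sequence $\{j_n\}_{n\ge1}\subset\mathbb{N}$ such that for all $n,m\in\mathbb{N}$ $$P(u,v,B_k)=\frac{\lambda(B_k\cap B_n)}{2\lambda(B_n)}+\frac{\lambda(B_k\cap B_m)}{2\lambda(B_m)}\qquad\text{for all }(u,v)\in B_{j_n}\times B_{j_m}\text{ and all }k\in\mathbb{N}.$$ Then $\mathcal{V}$ is a projective surjection.
   Context: $\mathbb{N}=\{1,2,3,\dots\}$. $S(X)$ is the set of all probability measures on $(X,\mathcal{F})$ absolutely continuous with respect to $\lambda$. A partition of $X$ (w.r.t. $\lambda$) is a countably infinite family $\mathcal{B}=\{B_k\}_{k\ge1}$ of measurable sets with $X=\bigcup_{k\ge1}B_k$, $B_i\cap B_j=\emptyset$ for $i\ne j$, and $0<\lambda(B_k)<\infty$ for every $k\ge1$; $\mathcal{P}(X)$ denotes the set of all partitions of $X$. For $\mathcal{B}\in\mathcal{P}(X)$ and $\mathbf{x}=(x_k)_{k\ge1}\in\ell^1$ put $\mu_{\mathbf{x}}^{\mathcal{B}}(A)=\sum_{k=1}^\infty\frac{x_k}{\lambda(B_k)}\lambda(A\cap B_k)$, $A\in\mathcal{F}$, and $M(X,\mathcal{B})=\{\mu_{\mathbf{x}}^{\mathcal{B}}\in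 S(X):\mathbf{x}\in\ell^1\}$. A transition kernel is a function $P:X\times X\times\mathcal{F}\to[0,1]$, measurable in $(u,v)\in X\times X$ for each fixed $A\in\mathcal{F}$, with $P(u,v,A)=P(v,u,A)$ for all $u,v\in X$, $A\in\mathcal{F}$, and $P(u,v,\cdot)\in S(X)$ for all $u,v\in X$. It defines a quadratic stochastic operator (QSO) $\mathcal{V}:S(X)\to S(X)$ by $(\mathcal{V}\mu)(A)=\int_X\int_X P(u,v,A)\,d\mu(u)\,d\mu(v)$ for $\mu\in S(X)$, $A\in\mathcal{F}$. A QSO $\mathcal{V}$ is called a projective surjection if it is surjective on $M(X,\mathcal{B}')$, i.e. $\mathcal{V}(M(X,\mathcal{B}'))=M(X,\mathcal{B}')$, for some $\mathcal{B}'\in\mathcal{P}(X)$. *)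

theory Defs
  imports "HOL-Probability.Probability"
begin

text \<open>
  A measure space \<open>(X, F, \<lambda>)\<close> is a value \<open>L :: 'a measure\<close>, with \<open>X = space L\<close> and \<open>F = sets L\<close>.
  Probability measures on \<open>(X, F)\<close> are again values of type \<open>'a measure\<close>, so equality of such
  measures is equality on all of \<open>F\<close>.  Families written \<open>(a\<^sub>k)\<close> with \<open>k \<ge> 1\<close> are functions on
  \<open>nat\<close>, with the index shifted by one.
\<close>

definition ac_probs :: "'a measure \<Rightarrow> 'a measure set" where
  "ac_probs L = {\<mu>. sets \<mu> = sets L \<and> prob_space \<mu> \<and> absolutely_continuous L \<mu>}"

definition is_partition :: "'a measure \<Rightarrow> (nat \<Rightarrow> 'a set) \<Rightarrow> bool" where
  "is_partition L B \<longleftrightarrow>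
     (\<forall>k. B k \<in> sets L) \<and> space L = (\<Union>k. B k) \<and> (\<forall>i j. i \<noteq> j \<longrightarrow> B i \<inter> B j = {}) \<and>
     (\<forall>k. 0 < emeasure L (B k) \<and> emeasure L (B k) < \<infinity>)"

text \<open>The signed set function \<open>\<mu>\<^sub>x\<close> on \<open>sets L\<close>; for \<open>x\<close> in \<open>\<ell>\<^sup>1\<close> the series converges absolutely.\<close>

definition step_charge :: "'a measure \<Rightarrow> (nat \<Rightarrow> 'a set) \<Rightarrow> (nat \<Rightarrow> real) \<Rightarrow> 'a set \<Rightarrow> real" where
  "step_charge L B x A = (\<Sum>k. x k / measure L (B k) * measure L (A \<inter> B k))"

definition step_probs :: "'a measure \<Rightarrow> (nat \<Rightarrow> 'a set) \<Rightarrow> 'a measure set" where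
  "step_probs L B =
     {\<mu> \<in> ac_probs L. \<exists>x. summable (\<lambda>k. \<bar>x k\<bar>) \<and> (\<forall>A\<in>sets L. measure \<mu> A = step_charge L B x A)}"

text \<open>
  The number \<open>P(u,v,A)\<close> is \<open>measure (P u v) A\<close>; it lies in \<open>[0,1]\<close> because \<open>P u v\<close> is a
  probability measure.  Values of \<open>P\<close> outside \<open>space L\<close> are irrelevant.
\<close>

definition transition_kernel :: "'a measure \<Rightarrow> ('a \<Rightarrow> 'a \<Rightarrow> 'a measure) \<Rightarrow> bool" where
  "transition_kernel L P \<longleftrightarrow>
     (\<forall>A\<in>sets L. (\<lambda>(u, v). measure (P u v) A) \<in> borel_measurable (L \<Otimes>\<^sub>M L)) \<and>
     (\<forall>u\<in>space L. \<forall>v\<in>space L. \<forall>A\<in>sets L. measure (P u v) A = measure (P v u) A) \<and>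
     (\<forall>u\<in>space L. \<forall>v\<in>space L. P u v \<in> ac_probs L)"

definition qso :: "'a measure \<Rightarrow> ('a \<Rightarrow> 'a \<Rightarrow> 'a measure) \<Rightarrow> 'a measure \<Rightarrow> 'a measure" where
  "qso L P \<mu> = measure_of (space L) (sets L)
     (\<lambda>A. ennreal (\<integral>v. (\<integral>u. measure (P u v) A \<partial>\<mu>) \<partial>\<mu>))"

definition projective_surjection :: "'a measure \<Rightarrow> ('a measure \<Rightarrow> 'a measure) \<Rightarrow> bool" where
  "projective_surjection L V \<longleftrightarrow>
     (\<exists>B'. is_partition L B' \<and> V ` step_probs L B' = step_probs L B')"

text \<open>
  \<open>measure_of\<close> returns the null measure when its argument is not countably additive.  The
  following lemmas show that this does not happen: \<open>qso L P\<close> is the operator on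
  \<open>ac_probs L\<close> given by the double integral.
\<close>

lemma qso_integral_eq:
  assumes K: "transition_kernel L P" and \<mu>: "\<mu> \<in> ac_probs L" and A: "A \<in> sets L"
  shows "ennreal (\<integral>v. (\<integral>u. measure (P u v) A \<partial>\<mu>) \<partial>\<mu>)
       = (\<integral>\<^sup>+v. (\<integral>\<^sup>+u. emeasure (P u v) A \<partial>\<mu>) \<partial>\<mu>)" (is ?eq)
    and "(\<lambda>(v, u). emeasure (P u v) A) \<in> borel_measurable (\<mu> \<Otimes>\<^sub>M \<mu>)" (is ?meas)
proof -
  have sets\<mu>[measurable_cong]: "sets \<mu> = sets L" and ps: "prob_space \<mu>"
    using \<mu> by (auto simp: ac_probs_def)
  have sp: "space \<mu> = space L"
    using sets\<mu> by (rule sets_eq_imp_space_eq)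
  interpret prob_space \<mu> by (rule ps)
  have P: "prob_space (P u v)" if "u \<in> space \<mu>" "v \<in> space \<mu>" for u v
    using K that unfolding transition_kernel_def ac_probs_def sp by auto
  have em: "emeasure (P u v) A = ennreal (measure (P u v) A)"
    if "u \<in> space \<mu>" "v \<in> space \<mu>" for u v
    using P[OF that] by (simp add: finite_measure.emeasure_eq_measure prob_space_def)
  have le1: "measure (P u v) A \<le> 1" if "u \<in> space \<mu>" "v \<in> space \<mu>" for u v
    using P[OF that] by (rule prob_space.prob_le_1)
  have [measurable]: "(\<lambda>(u, v). measure (P u v) A) \<in> borel_measurable (\<mu> \<Otimes>\<^sub>M \<mu>)"
    using K A unfolding transition_kernel_def
    by (simp cong: measurable_cong_sets add: sets_pair_measure_cong[OF sets\<mu> sets\<mu>])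
  have m[measurable]: "(\<lambda>(v, u). measure (P u v) A) \<in> borel_measurable (\<mu> \<Otimes>\<^sub>M \<mu>)"
    by measurable
  show ?meas
    by (subst measurable_cong[where g = "\<lambda>(v, u). ennreal (measure (P u v) A)"])
       (auto simp: space_pair_measure em)
  have int: "integrable \<mu> (\<lambda>u. measure (P u v) A)" if v: "v \<in> space \<mu>" for v
  proof (rule integrable_const_bound[where B = 1])
    show "AE u in \<mu>. norm (measure (P u v) A) \<le> 1"
      by (rule AE_I2) (simp add: le1 v)
    show "(\<lambda>u. measure (P u v) A) \<in> borel_measurable \<mu>"
      using measurable_Pair2[OF m v] by simp
  qed
  have inner: "(\<integral>\<^sup>+u. emeasure (P u v) A \<partial>\<mu>) = ennreal (\<integral>u. measure (P u v) A \<partial>\<mu>)"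
    if v: "v \<in> space \<mu>" for v
  proof -
    have "(\<integral>\<^sup>+u. ennreal (measure (P u v) A) \<partial>\<mu>) = ennreal (\<integral>u. measure (P u v) A \<partial>\<mu>)"
      by (rule nn_integral_eq_integral[OF int[OF v]]) auto
    then show ?thesis
      by (simp add: em v cong: nn_integral_cong)
  qed
  have "integrable \<mu> (\<lambda>v. \<integral>u. measure (P u v) A \<partial>\<mu>)"
  proof (rule integrable_const_bound[where B = 1])
    have "(\<integral>u. measure (P u v) A \<partial>\<mu>) \<le> 1" if v: "v \<in> space \<mu>" for v
      by (rule integral_le_const[OF int[OF v]]) (rule AE_I2, simp add: le1 v)
    then show "AE v in \<mu>. norm (\<integral>u. measure (P u v) A \<partial>\<mu>) \<le> 1"
      by (intro AE_I2) (simp add: integral_nonneg_AE)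
    show "(\<lambda>v. \<integral>u. measure (P u v) A \<partial>\<mu>) \<in> borel_measurable \<mu>"
      by measurable
  qed
  then have "(\<integral>\<^sup>+v. ennreal (\<integral>u. measure (P u v) A \<partial>\<mu>) \<partial>\<mu>)
      = ennreal (\<integral>v. (\<integral>u. measure (P u v) A \<partial>\<mu>) \<partial>\<mu>)"
    by (rule nn_integral_eq_integral) auto
  then show ?eq
    by (simp add: inner cong: nn_integral_cong)
qed

lemma emeasure_qso:
  assumes K: "transition_kernel L P" and \<mu>: "\<mu> \<in> ac_probs L" and A: "A \<in> sets L"
  shows "emeasure (qso L P \<mu>) A = ennreal (\<integral>v. (\<integral>u. measure (P u v) A \<partial>\<mu>) \<partial>\<mu>)"
proof (rule emeasure_measure_of[OF qso_def])
  have sets\<mu>[measurable_cong]: "sets \<mu> = sets L" and ps: "prob_space \<mu>"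
    using \<mu> by (auto simp: ac_probs_def)
  have sp: "space \<mu> = space L"
    using sets\<mu> by (rule sets_eq_imp_space_eq)
  interpret prob_space \<mu> by (rule ps)
  show "sets L \<subseteq> Pow (space L)" by (rule sets.space_closed)
  show "A \<in> sets (qso L P \<mu>)" using A by (simp add: qso_def)
  show "positive (sets (qso L P \<mu>)) (\<lambda>A. ennreal (\<integral>v. (\<integral>u. measure (P u v) A \<partial>\<mu>) \<partial>\<mu>))"
    by (simp add: positive_def)
  show "countably_additive (sets (qso L P \<mu>)) (\<lambda>A. ennreal (\<integral>v. (\<integral>u. measure (P u v) A \<partial>\<mu>) \<partial>\<mu>))"
  proof (rule countably_additiveI)
    fix C :: "nat \<Rightarrow> 'a set"
    assume "range C \<subseteq> sets (qso L P \<mu>)" and dis: "disjoint_family C"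
    then have C: "C i \<in> sets L" for i by (auto simp: qso_def)
    have U: "(\<Union>i. C i) \<in> sets L" using C by auto
    have m[measurable]: "(\<lambda>(v, u). emeasure (P u v) (C i)) \<in> borel_measurable (\<mu> \<Otimes>\<^sub>M \<mu>)" for i
      by (rule qso_integral_eq(2)[OF K \<mu> C])
    have ad: "emeasure (P u v) (\<Union>i. C i) = (\<Sum>i. emeasure (P u v) (C i))"
      if "u \<in> space \<mu>" "v \<in> space \<mu>" for u v
    proof -
      have "sets (P u v) = sets L"
        using K that unfolding transition_kernel_def ac_probs_def sp by auto
      then show ?thesis
        using C dis by (intro suminf_emeasure[symmetric]) auto
    qed
    have "(\<Sum>i. ennreal (\<integral>v. (\<integral>u. measure (P u v) (C i) \<partial>\<mu>) \<partial>\<mu>))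
        = (\<Sum>i. \<integral>\<^sup>+v. (\<integral>\<^sup>+u. emeasure (P u v) (C i) \<partial>\<mu>) \<partial>\<mu>)"
      by (simp add: qso_integral_eq(1)[OF K \<mu> C])
    also have "\<dots> = (\<integral>\<^sup>+v. (\<Sum>i. \<integral>\<^sup>+u. emeasure (P u v) (C i) \<partial>\<mu>) \<partial>\<mu>)"
      by (rule nn_integral_suminf[symmetric]) measurable
    also have "\<dots> = (\<integral>\<^sup>+v. (\<integral>\<^sup>+u. (\<Sum>i. emeasure (P u v) (C i)) \<partial>\<mu>) \<partial>\<mu>)"
      by (intro nn_integral_cong nn_integral_suminf[symmetric])
         (use measurable_Pair2[OF m] in simp)
    also have "\<dots> = (\<integral>\<^sup>+v. (\<integral>\<^sup>+u. emeasure (P u v) (\<Union>i. C i) \<partial>\<mu>) \<partial>\<mu>)"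
      by (intro nn_integral_cong) (simp add: ad)
    also have "\<dots> = ennreal (\<integral>v. (\<integral>u. measure (P u v) (\<Union>i. C i) \<partial>\<mu>) \<partial>\<mu>)"
      by (rule qso_integral_eq(1)[OF K \<mu> U, symmetric])
    finally show "(\<Sum>i. ennreal (\<integral>v. (\<integral>u. measure (P u v) (C i) \<partial>\<mu>) \<partial>\<mu>))
        = ennreal (\<integral>v. (\<integral>u. measure (P u v) (\<Union>i. C i) \<partial>\<mu>) \<partial>\<mu>)" .
  qed
qed

lemma measure_qso:
  assumes "transition_kernel L P" "\<mu> \<in> ac_probs L" "A \<in> sets L"
  shows "measure (qso L P \<mu>) A = (\<integral>v. (\<integral>u. measure (P u v) A \<partial>\<mu>) \<partial>\<mu>)"
  by (simp add: measure_def[of "qso L P \<mu>"] emeasure_qso[OF assms] integral_nonneg_AE)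

lemma qso_in_ac_probs:
  assumes K: "transition_kernel L P" and \<mu>: "\<mu> \<in> ac_probs L"
  shows "qso L P \<mu> \<in> ac_probs L"
proof -
  have sets\<mu>: "sets \<mu> = sets L" and ps: "prob_space \<mu>"
    using \<mu> by (auto simp: ac_probs_def)
  have sp: "space \<mu> = space L"
    using sets\<mu> by (rule sets_eq_imp_space_eq)
  interpret prob_space \<mu> by (rule ps)
  have P: "prob_space (P u v)" "sets (P u v) = sets L" "absolutely_continuous L (P u v)"
    if "u \<in> space \<mu>" "v \<in> space \<mu>" for u v
    using K that unfolding transition_kernel_def ac_probs_def sp by auto
  have s: "sets (qso L P \<mu>) = sets L" "space (qso L P \<mu>) = space L"
    by (simp_all add: qso_def)
  have one: "emeasure (P u v) (space L) = 1" if "u \<in> space \<mu>" "v \<in> space \<mu>" for u v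
    using prob_space.emeasure_space_1[OF P(1)[OF that]] sets_eq_imp_space_eq[OF P(2)[OF that]]
    by simp
  have "emeasure (qso L P \<mu>) (space L) = (\<integral>\<^sup>+v. (\<integral>\<^sup>+u. emeasure (P u v) (space L) \<partial>\<mu>) \<partial>\<mu>)"
    by (simp add: emeasure_qso[OF K \<mu>] qso_integral_eq(1)[OF K \<mu>])
  also have "\<dots> = (\<integral>\<^sup>+v. (\<integral>\<^sup>+u. 1 \<partial>\<mu>) \<partial>\<mu>)"
    by (intro nn_integral_cong) (simp add: one)
  also have "\<dots> = 1"
    by (simp add: emeasure_space_1)
  finally have "prob_space (qso L P \<mu>)"
    by (intro prob_spaceI) (simp add: s)
  moreover have "absolutely_continuous L (qso L P \<mu>)"
    unfolding absolutely_continuous_def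
  proof
    fix N assume N: "N \<in> null_sets L"
    then have NL: "N \<in> sets L" by auto
    have z: "emeasure (P u v) N = 0" if "u \<in> space \<mu>" "v \<in> space \<mu>" for u v
      using P(3)[OF that] N unfolding absolutely_continuous_def by auto
    have "emeasure (qso L P \<mu>) N = (\<integral>\<^sup>+v. (\<integral>\<^sup>+u. emeasure (P u v) N \<partial>\<mu>) \<partial>\<mu>)"
      by (simp add: emeasure_qso[OF K \<mu> NL] qso_integral_eq(1)[OF K \<mu> NL])
    also have "\<dots> = (\<integral>\<^sup>+v. (\<integral>\<^sup>+u. 0 \<partial>\<mu>) \<partial>\<mu>)"
      by (intro nn_integral_cong) (simp add: z)
    finally show "N \<in> null_sets (qso L P \<mu>)"
      using NL by (auto simp: s null_sets_def)
  qed
  ultimately show ?thesis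
    by (simp add: ac_probs_def s)
qed

end

theory Submission
  imports Defs
begin

text \<open>
  The partition \<open>B\<close> itself witnesses the projective surjection.

  A probability measure lies in \<open>step_probs L B\<close> exactly when, inside each cell \<open>B k\<close>, it is
  proportional to \<open>L\<close> (\<open>step_probs_iff_proportional\<close>).  Two consequences carry the proof.
  This condition consists of linear equations between the values of the measure, so it passes from
  the kernel measures \<open>P u v\<close> to their average \<open>qso L P \<mu>\<close>; hence \<open>qso L P\<close> maps \<open>ac_probs L\<close>,
  and in particular \<open>step_probs L B\<close>, into \<open>step_probs L B\<close> (\<open>qso_in_step_probs\<close>).
  Moreover, an element of \<open>step_probs L B\<close> is determined by its masses on the cells
  (\<open>step_probs_eqI\<close>).

  For surjectivity, let \<open>\<nu>\<close> be in \<open>step_probs L B\<close>.  The preimage \<open>\<mu>\<close> puts the mass that \<open>\<nu>\<close> has on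
  \<open>B n\<close> uniformly on the cell \<open>B (j n)\<close>; the map \<open>j\<close> is injective because the kernel measures
  distinguish the cells \<open>B (j n)\<close>.  On the union of these cells, which has full \<open>\<mu>\<close>-measure, the
  hypothesis on the kernel says that the mass \<open>P u v (B k)\<close> is the mean of the indicators of
  \<open>u \<in> B (j k)\<close> and \<open>v \<in> B (j k)\<close>.  Integrating, \<open>qso L P \<mu>\<close> has mass \<open>\<mu> (B (j k)) = \<nu> (B k)\<close> on
  \<open>B k\<close>, and therefore it is \<open>\<nu>\<close>.
\<close>

section \<open>Measures proportional to a reference measure on the cells of a partition\<close>

lemma partition_measure_pos:
  assumes "is_partition L B"
  shows "0 < measure L (B k)"
  using assms unfolding is_partition_def
  by (simp add: emeasure_eq_ennreal_measure measure_def enn2real_positive_iff)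

lemma partition_mem_cell_iff:
  assumes "is_partition L B" "x \<in> B i"
  shows "x \<in> B k \<longleftrightarrow> k = i"
  using assms unfolding is_partition_def by blast

lemma partition_measure_sums:
  assumes B: "is_partition L B" and \<mu>: "\<mu> \<in> ac_probs L" and A: "A \<in> sets L"
  shows "(\<lambda>k. measure \<mu> (A \<inter> B k)) sums measure \<mu> A"
proof -
  have s: "sets \<mu> = sets L" and "prob_space \<mu>"
    using \<mu> by (auto simp: ac_probs_def)
  then interpret prob_space \<mu> by simp
  have "(\<lambda>k. measure \<mu> (A \<inter> B k)) sums measure \<mu> (\<Union>k. A \<inter> B k)"
    using B A s by (intro finite_measure_UNION)
      (auto simp: is_partition_def disjoint_family_on_def partition_mem_cell_iff[OF B])
  also have "(\<Union>k. A \<inter> B k) = A"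
    using B sets.sets_into_space[OF A] by (auto simp: is_partition_def)
  finally show ?thesis .
qed

text \<open>
  Evaluating the defining series on a subset of \<open>B k\<close> leaves only its \<open>k\<close>-th term, so the
  coefficient \<open>x k\<close> can only be the mass of \<open>B k\<close>.  The product form of the proportionality makes
  it linear in \<open>\<mu>\<close>.
\<close>

lemma step_probs_iff_proportional:
  assumes B: "is_partition L B"
  shows "\<mu> \<in> step_probs L B \<longleftrightarrow> \<mu> \<in> ac_probs L \<and>
    (\<forall>A\<in>sets L. \<forall>k. measure \<mu> (A \<inter> B k) = measure L (A \<inter> B k) / measure L (B k) * measure \<mu> (B k))"
    (is "_ \<longleftrightarrow> _ \<and> ?prop")
proof (intro iffI conjI)
  assume "\<mu> \<in> step_probs L B"
  then obtain x where x: "\<And>A. A \<in> sets L \<Longrightarrow> measure \<mu> A = step_charge L B x A" and "\<mu> \<in> ac_probs L"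
    by (auto simp: step_probs_def)
  then show "\<mu> \<in> ac_probs L" by simp
  have sets_B: "B k \<in> sets L" for k
    using B by (simp add: is_partition_def)
  have loc: "measure \<mu> (A \<inter> B k) = x k / measure L (B k) * measure L (A \<inter> B k)"
    if A: "A \<in> sets L" for A k
  proof -
    have "step_charge L B x (A \<inter> B k) =
        (\<Sum>i. if i = k then x i / measure L (B i) * measure L (A \<inter> B i) else 0)"
      unfolding step_charge_def
    proof (intro suminf_cong)
      fix i
      have "i \<noteq> k \<Longrightarrow> A \<inter> B k \<inter> B i = {}"
        by (auto simp: partition_mem_cell_iff[OF B])
      then show "x i / measure L (B i) * measure L (A \<inter> B k \<inter> B i) =
          (if i = k then x i / measure L (B i) * measure L (A \<inter> B i) else 0)"
        by (auto simp: Int_assoc)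
    qed
    also have "\<dots> = x k / measure L (B k) * measure L (A \<inter> B k)"
      using sums_single[of k "\<lambda>i. x i / measure L (B i) * measure L (A \<inter> B i)"]
      by (rule sums_unique[symmetric])
    finally show ?thesis
      using x[of "A \<inter> B k"] A sets_B by auto
  qed
  have "measure \<mu> (B k) = x k" for k
    using loc[OF sets_B, of k k] partition_measure_pos[OF B, of k] by simp
  then show ?prop
    using loc by simp
next
  assume *: "\<mu> \<in> ac_probs L \<and> ?prop"
  have "space L \<in> sets L" by simp
  from partition_measure_sums[OF B _ this] * have "(\<lambda>k. measure \<mu> (space L \<inter> B k)) sums measure \<mu> (space L)"
    by blast
  moreover have "space L \<inter> B k = B k" for k
    using B by (auto simp: is_partition_def)
  ultimately have "summable (\<lambda>k. \<bar>measure \<mu> (B k)\<bar>)"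
    by (simp add: sums_iff)
  moreover have "measure \<mu> A = step_charge L B (\<lambda>k. measure \<mu> (B k)) A" if A: "A \<in> sets L" for A
    using partition_measure_sums[OF B conjunct1[OF *] A] * A
    by (simp add: step_charge_def sums_iff mult.commute)
  ultimately show "\<mu> \<in> step_probs L B"
    using conjunct1[OF *] unfolding step_probs_def
    by (intro CollectI conjI exI[of _ "\<lambda>k. measure \<mu> (B k)"] ballI) simp_all
qed

lemma step_probs_eqI:
  assumes B: "is_partition L B" and \<mu>: "\<mu> \<in> step_probs L B" and \<nu>: "\<nu> \<in> step_probs L B"
    and eq: "\<And>k. measure \<mu> (B k) = measure \<nu> (B k)"
  shows "\<mu> = \<nu>"
proof (rule measure_eqI)
  have ac: "\<mu> \<in> ac_probs L" "\<nu> \<in> ac_probs L"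
    using \<mu> \<nu> by (auto simp: step_probs_def)
  then have s: "sets \<mu> = sets L" "sets \<nu> = sets L" and fin: "finite_measure \<mu>" "finite_measure \<nu>"
    by (auto simp: ac_probs_def prob_space_def)
  show "sets \<mu> = sets \<nu>" by (simp add: s)
  fix A assume "A \<in> sets \<mu>"
  then have A: "A \<in> sets L" by (simp add: s)
  have "measure \<mu> (A \<inter> B k) = measure \<nu> (A \<inter> B k)" for k
    using \<mu> \<nu> A eq by (simp add: step_probs_iff_proportional[OF B])
  then have "measure \<mu> A = measure \<nu> A"
    using partition_measure_sums[OF B ac(1) A] partition_measure_sums[OF B ac(2) A]
    by (simp add: sums_iff)
  then show "emeasure \<mu> A = emeasure \<nu> A"
    using fin by (simp add: finite_measure.emeasure_eq_measure)
qed

section \<open>Invariance under the quadratic stochastic operator\<close>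

lemma qso_in_step_probs:
  assumes B: "is_partition L B" and K: "transition_kernel L P"
    and P: "\<And>u v. u \<in> space L \<Longrightarrow> v \<in> space L \<Longrightarrow> P u v \<in> step_probs L B"
    and \<mu>: "\<mu> \<in> ac_probs L"
  shows "qso L P \<mu> \<in> step_probs L B"
  unfolding step_probs_iff_proportional[OF B]
proof (intro conjI ballI allI)
  show "qso L P \<mu> \<in> ac_probs L"
    by (rule qso_in_ac_probs[OF K \<mu>])
  fix A k assume A: "A \<in> sets L"
  have Bk: "B k \<in> sets L"
    using B by (simp add: is_partition_def)
  have sp: "space \<mu> = space L"
    using \<mu> by (intro sets_eq_imp_space_eq) (simp add: ac_probs_def)
  let ?c = "measure L (A \<inter> B k) / measure L (B k)"
  have "measure (P u v) (A \<inter> B k) = ?c * measure (P u v) (B k)"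
    if "u \<in> space L" "v \<in> space L" for u v
    using P[OF that] A by (simp add: step_probs_iff_proportional[OF B])
  then have "(\<integral>v. (\<integral>u. measure (P u v) (A \<inter> B k) \<partial>\<mu>) \<partial>\<mu>)
      = (\<integral>v. (\<integral>u. ?c * measure (P u v) (B k) \<partial>\<mu>) \<partial>\<mu>)"
    by (intro Bochner_Integration.integral_cong) (auto simp: sp)
  then show "measure (qso L P \<mu>) (A \<inter> B k) = ?c * measure (qso L P \<mu>) (B k)"
    using A Bk by (simp add: measure_qso[OF K \<mu>])
qed

section \<open>Prescribed masses on selected cells\<close>

text \<open>
  The required measure has a density that is constant on each cell.  The cells outside the
  range of \<open>j\<close> receive no mass, because the masses \<open>y n\<close> already add up to one.
\<close>

lemma ex_step_prob_on_cells:
  fixes y :: "nat \<Rightarrow> real"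
  assumes B: "is_partition L B" and j: "inj j" and y: "\<And>n. 0 \<le> y n" "y sums 1"
  obtains \<mu> where "\<mu> \<in> step_probs L B" and "\<And>n. measure \<mu> (B (j n)) = y n"
proof -
  define c where "c n = ennreal (y n / measure L (B (j n)))" for n
  define f where "f x = (\<Sum>n. c n * indicator (B (j n)) x)" for x
  define \<mu> where "\<mu> = density L f"
  have [measurable]: "B k \<in> sets L" for k
    using B by (simp add: is_partition_def)
  have f[measurable]: "f \<in> borel_measurable L"
    unfolding f_def by measurable
  have fin: "emeasure L (A \<inter> B k) = ennreal (measure L (A \<inter> B k))" if [measurable]: "A \<in> sets L" for A k
  proof (rule emeasure_eq_ennreal_measure)
    have "emeasure L (A \<inter> B k) \<le> emeasure L (B k)"
      by (rule emeasure_mono) auto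
    also have "\<dots> < \<infinity>"
      using B by (simp add: is_partition_def)
    finally show "emeasure L (A \<inter> B k) \<noteq> top" by simp
  qed
  have em: "emeasure \<mu> A = (\<Sum>n. c n * emeasure L (A \<inter> B (j n)))" if [measurable]: "A \<in> sets L" for A
  proof -
    have "emeasure \<mu> A = (\<integral>\<^sup>+x. (\<Sum>n. c n * indicator (A \<inter> B (j n)) x) \<partial>L)"
      unfolding \<mu>_def emeasure_density[OF f that] f_def
      by (intro nn_integral_cong) (auto simp: indicator_def)
    also have "\<dots> = (\<Sum>n. \<integral>\<^sup>+x. c n * indicator (A \<inter> B (j n)) x \<partial>L)"
      by (rule nn_integral_suminf) measurable
    also have "\<dots> = (\<Sum>n. c n * emeasure L (A \<inter> B (j n)))"
      by (intro suminf_cong nn_integral_cmult_indicator) measurable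
    finally show ?thesis .
  qed
  have space_Int: "space L \<inter> B k = B k" for k
    using B by (auto simp: is_partition_def)
  have cell: "c n * emeasure L (B (j n)) = ennreal (y n)" for n
    using fin[OF sets.top, of "j n"] partition_measure_pos[OF B, of "j n"] y(1)[of n]
    by (simp add: c_def space_Int flip: ennreal_mult)
  have "emeasure \<mu> (space \<mu>) = 1"
  proof -
    have "emeasure \<mu> (space \<mu>) = (\<Sum>n. ennreal (y n))"
      using em[OF sets.top] by (simp add: \<mu>_def space_Int cell)
    also have "\<dots> = ennreal 1"
      using y by (rule suminf_ennreal_eq)
    finally show ?thesis by simp
  qed
  then interpret prob_space \<mu> by (rule prob_spaceI)
  have ac: "\<mu> \<in> ac_probs L"
    using prob_space_axioms absolutely_continuousI_density[OF f] by (simp add: ac_probs_def \<mu>_def)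
  have disj: "A \<inter> B k \<inter> B i = (if i = k then A \<inter> B k else {})" for A k i
    by (auto simp: partition_mem_cell_iff[OF B])
  have on_cell: "measure \<mu> (A \<inter> B (j n)) = y n / measure L (B (j n)) * measure L (A \<inter> B (j n))"
    if A[measurable]: "A \<in> sets L" for A n
  proof -
    have "emeasure \<mu> (A \<inter> B (j n)) = (\<Sum>i. if i = n then c i * emeasure L (A \<inter> B (j i)) else 0)"
      by (subst em) (auto intro!: suminf_cong simp: disj inj_eq[OF j])
    also have "\<dots> = c n * emeasure L (A \<inter> B (j n))"
      using sums_single[of n "\<lambda>i. c i * emeasure L (A \<inter> B (j i))"]
      by (rule sums_unique[symmetric])
    also have "\<dots> = ennreal (y n / measure L (B (j n)) * measure L (A \<inter> B (j n)))"
      using y(1)[of n] by (simp add: fin[OF A] c_def flip: ennreal_mult)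
    finally show ?thesis
      using y(1)[of n] by (simp add: measure_def[of \<mu>])
  qed
  have off_cell: "measure \<mu> (A \<inter> B k) = 0" if A[measurable]: "A \<in> sets L" and k: "k \<notin> range j" for A k
  proof -
    have "j i \<noteq> k" for i
      using k by auto
    then have "emeasure \<mu> (A \<inter> B k) = 0"
      by (subst em) (auto simp: disj)
    then show ?thesis by (simp add: measure_def)
  qed
  have mass: "measure \<mu> (B (j n)) = y n" for n
    using on_cell[OF sets.top, of n] partition_measure_pos[OF B, of "j n"] by (simp add: space_Int)
  have "measure \<mu> (A \<inter> B k) = measure L (A \<inter> B k) / measure L (B k) * measure \<mu> (B k)"
    if "A \<in> sets L" for A k
    using on_cell[OF that] mass off_cell[OF that, of k] off_cell[OF sets.top, of k] space_Int[of k]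
    by (cases "k \<in> range j") auto
  then have "\<mu> \<in> step_probs L B"
    using ac by (simp add: step_probs_iff_proportional[OF B])
  then show thesis
    using mass that by blast
qed

section \<open>Surjectivity\<close>

text \<open>
  If two indices had the same value \<open>j n = j m\<close>, the kernel measure \<open>P u u\<close> at a point \<open>u\<close> of that
  cell would give mass one to both \<open>B n\<close> and \<open>B m\<close>.
\<close>

lemma cell_selection_inj:
  assumes B: "is_partition L B"
    and j: "\<And>n u v k. u \<in> B (j n) \<Longrightarrow> v \<in> B (j n) \<Longrightarrow> measure (P u v) (B k) = of_bool (k = n)"
  shows "inj j"
proof (rule injI)
  fix n m :: nat assume eq: "j n = j m"
  have "B (j n) \<noteq> {}"
    using partition_measure_pos[OF B, of "j n"] by auto
  then obtain u where "u \<in> B (j n)" by auto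
  then show "n = m"
    using j[of u n u n] j[of u m u n] eq by (simp split: if_splits)
qed

theorem theorem4p9:
  fixes L :: "'a measure" and B :: "nat \<Rightarrow> 'a set" and P :: "'a \<Rightarrow> 'a \<Rightarrow> 'a measure"
  assumes "sigma_finite_measure L"
    and "is_partition L B"
    and "transition_kernel L P"
    and "\<forall>u\<in>space L. \<forall>v\<in>space L. P u v \<in> step_probs L B"
    and "\<exists>j :: nat \<Rightarrow> nat. \<forall>n m. \<forall>u\<in>B (j n). \<forall>v\<in>B (j m). \<forall>k.
           measure (P u v) (B k) =
             measure L (B k \<inter> B n) / (2 * measure L (B n)) +
             measure L (B k \<inter> B m) / (2 * measure L (B m))"
  shows "projective_surjection L (qso L P)"
proof -
  note B = assms(2) and K = assms(3) and P = assms(4)[rule_format]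
  from assms(5) obtain j :: "nat \<Rightarrow> nat" where
    j: "\<And>n m u v k. u \<in> B (j n) \<Longrightarrow> v \<in> B (j m) \<Longrightarrow> measure (P u v) (B k) =
             measure L (B k \<inter> B n) / (2 * measure L (B n)) +
             measure L (B k \<inter> B m) / (2 * measure L (B m))"
    by blast
  have half: "measure L (B k \<inter> B n) / (2 * measure L (B n)) = of_bool (k = n) / 2" for k n
  proof (cases "k = n")
    case True
    then show ?thesis
      using partition_measure_pos[OF B, of n] by simp
  next
    case False
    then have "B k \<inter> B n = {}"
      using B by (simp add: is_partition_def)
    then show ?thesis
      using False by simp
  qed
  then have P_cell: "measure (P u v) (B k) = of_bool (k = n) / 2 + of_bool (k = m) / 2"
    if "u \<in> B (j n)" "v \<in> B (j m)" for u v n m k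
    by (simp only: j[OF that] half)
  have inj: "inj j"
    by (rule cell_selection_inj[OF B, of j P]) (simp add: P_cell)
  have sets_B: "B k \<in> sets L" for k
    using B by (simp add: is_partition_def)
  have P_ind: "measure (P u v) (B k) = indicator (B (j k)) u / 2 + indicator (B (j k)) v / 2"
    if u: "u \<in> (\<Union>n. B (j n))" and v: "v \<in> (\<Union>n. B (j n))" for u v k
  proof -
    from u v obtain n m where nm: "u \<in> B (j n)" "v \<in> B (j m)" by auto
    have "x \<in> B (j k) \<longleftrightarrow> k = i" if "x \<in> B (j i)" for x i
      by (simp add: partition_mem_cell_iff[OF B that] inj_eq[OF inj])
    then show ?thesis
      using P_cell[OF nm] nm by (simp add: indicator_def)
  qed
  have "qso L P ` step_probs L B = step_probs L B"
  proof (intro antisym subsetI)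
    fix \<nu> assume "\<nu> \<in> qso L P ` step_probs L B"
    then show "\<nu> \<in> step_probs L B"
      using qso_in_step_probs[OF B K P] by (auto simp: step_probs_def)
  next
    fix \<nu> assume \<nu>: "\<nu> \<in> step_probs L B"
    then have \<nu>_ac: "\<nu> \<in> ac_probs L"
      by (simp add: step_probs_def)
    then have "measure \<nu> (space L) = 1"
      using prob_space.prob_space[of \<nu>] sets_eq_imp_space_eq[of \<nu> L] by (auto simp: ac_probs_def)
    moreover have "space L \<inter> B k = B k" for k
      using B by (auto simp: is_partition_def)
    ultimately have "(\<lambda>k. measure \<nu> (B k)) sums 1"
      using partition_measure_sums[OF B \<nu>_ac sets.top] by simp
    then obtain \<mu> where \<mu>: "\<mu> \<in> step_probs L B" and mass: "\<And>n. measure \<mu> (B (j n)) = measure \<nu> (B n)"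
      using ex_step_prob_on_cells[OF B inj, of "\<lambda>n. measure \<nu> (B n)"] by auto
    from \<mu> have \<mu>_ac: "\<mu> \<in> ac_probs L"
      by (simp add: step_probs_def)
    then have sets_\<mu>: "sets \<mu> = sets L" and "prob_space \<mu>"
      by (auto simp: ac_probs_def)
    then interpret prob_space \<mu> by simp
    have [measurable]: "B k \<in> sets \<mu>" for k
      using sets_B sets_\<mu> by simp
    have "(\<lambda>n. measure \<mu> (B (j n))) sums measure \<mu> (\<Union>n. B (j n))"
      using B inj by (intro finite_measure_UNION)
        (auto simp: disjoint_family_on_def inj_eq partition_mem_cell_iff[OF B])
    with \<open>(\<lambda>k. measure \<nu> (B k)) sums 1\<close> have "measure \<mu> (\<Union>n. B (j n)) = 1"
      unfolding mass by (metis sums_unique2)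
    then have AE_cells: "AE u in \<mu>. u \<in> (\<Union>n. B (j n))"
      by (intro iffD1[OF prob_eq_1]) auto
    have meas: "(\<lambda>(u, v). measure (P u v) (B k)) \<in> borel_measurable (\<mu> \<Otimes>\<^sub>M \<mu>)" for k
      using K sets_B unfolding transition_kernel_def
      by (simp cong: measurable_cong_sets add: sets_pair_measure_cong[OF sets_\<mu> sets_\<mu>])
    have "measure (qso L P \<mu>) (B k) = measure \<nu> (B k)" for k
    proof -
      have [measurable]: "(\<lambda>(v, u). measure (P u v) (B k)) \<in> borel_measurable (\<mu> \<Otimes>\<^sub>M \<mu>)"
        using meas[of k] by measurable
      have int: "integrable \<mu> (\<lambda>u. indicator (B (j k)) u / 2 :: real)"
        by (rule integrable_const_bound[where B = 1]) (auto simp: indicator_def)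
      have inner: "(\<integral>u. measure (P u v) (B k) \<partial>\<mu>)
          = measure \<mu> (B (j k)) / 2 + indicator (B (j k)) v / 2"
        if v: "v \<in> (\<Union>n. B (j n))" for v
      proof -
        from v have "v \<in> space \<mu>"
          using sets.sets_into_space[of "B _" \<mu>] by auto
        moreover from AE_cells have "AE u in \<mu>.
            measure (P u v) (B k) = indicator (B (j k)) u / 2 + indicator (B (j k)) v / 2"
          by eventually_elim (rule P_ind[OF _ v])
        ultimately have "(\<integral>u. measure (P u v) (B k) \<partial>\<mu>)
            = (\<integral>u. indicator (B (j k)) u / 2 + indicator (B (j k)) v / 2 \<partial>\<mu>)"
          by (intro integral_cong_AE) auto
        also have "\<dots> = measure \<mu> (B (j k)) / 2 + indicator (B (j k)) v / 2"
          by (subst Bochner_Integration.integral_add) (auto simp: prob_space int)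
        finally show ?thesis .
      qed
      have "measure (qso L P \<mu>) (B k) = (\<integral>v. (\<integral>u. measure (P u v) (B k) \<partial>\<mu>) \<partial>\<mu>)"
        by (rule measure_qso[OF K \<mu>_ac sets_B])
      also have "\<dots> = (\<integral>v. measure \<mu> (B (j k)) / 2 + indicator (B (j k)) v / 2 \<partial>\<mu>)"
        using AE_cells by (intro integral_cong_AE) (auto simp: inner)
      also have "\<dots> = measure \<mu> (B (j k))"
        by (subst Bochner_Integration.integral_add) (auto simp: prob_space int)
      finally show ?thesis by (simp add: mass)
    qed
    then have "qso L P \<mu> = \<nu>"
      using qso_in_step_probs[OF B K P \<mu>_ac] \<nu> by (intro step_probs_eqI[OF B])
    then show "\<nu> \<in> qso L P ` step_probs L B"
      using \<mu> by blast
  qed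
  then show ?thesis
    unfolding projective_surjection_def using B by blast
qed

end
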